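(* Let $k\le n$ be non-negative integers, $\sigma\in S_n$, $I\subset\{1,\dots,n\}$ with $|I|=k$, and $a\in\{1,\dots,n-1\}$. The following identities of rational functions in $t_1,\dots,t_k,z_1,\dots,z_n,\hbar$ hold. (1) If ($\sigma(a)\in I$ and $\sigma(a+1)\notin I$) or ($\sigma(a)\notin I$ and $\sigma(a+1)\in I$), then for each $r\in\{00,10,01,11\}$ $$W^{(r)}_{\sigma s_{a,a+1},I}=\frac{z_{\sigma(a)}-z_{\sigma(a+1)}}{z_{\sigma(a+1)}-z_{\sigma(a)}+\hbar}W^{(r)}_{\sigma,I}+\frac{\hbar}{z_{\sigma(a+1)}-z_{\sigma(a)}+\hbar}W^{(r)}_{\sigma,s_{\sigma(a),\sigma(a+1)}(I)}.$$ (2) If $\sigma(a),\sigma(a+1)\in I$, then $$W^{(r)}_{\sigma s_{a,a+1},I}=W^{(r)}_{\sigma,I}\ \text{ for } r=00,01,\qquad W^{(r)}_{\sigma s_{a,a+1},I}=\frac{z_{\sigma(a)}-z_{\sigma(a+1)}+\hbar}{z_{\sigma(a+1)}-z_{\sigma(a)}+\hbar}W^{(r)}_{\sigma,I}\ \text{ for } r=10,11.$$ (3) If $\sigma(a),\sigma(a+1)\notin I$, then $$W^{(r)}_{\sigma s_{a,a+1},I}=W^{(r)}_{\sigma,I}\ \text{ for } r=00,10,\qquad W^{(r)}_{\sigma s_{a,a+1},I}=\frac{z_{\sigma(a)}-z_{\sigma(a+1)}+\hbar}{z_{\sigma(a+1)}-z_{\sigma(a)}+\hbar}W^{(r)}_{\sigma,I}\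 \text{ for } r=01,11.$$
   Context: $s_{a,b}\in S_n$ is the transposition of $a$ and $b$; $\sigma\omega$ means first apply $\omega$, then $\sigma$ (so $\sigma s_{a,a+1}$ is $\sigma$ with the values $\sigma(a),\sigma(a+1)$ switched). $s_{u,v}(I)$ is the image of the set $I$ under the transposition. Super weight functions. For $I$ with $|I|=k$ write $I=\{i_1<\dots<i_k\}$, and let $\mathrm{Sym}_k f=\sum_{\tau\in S_k}f(t_{\tau(1)},\dots,t_{\tau(k)})$. Put $W^{(r)}_I=\mathrm{Sym}_k(U^{(r)}_I)$ where $$U^{(00)}_I=\prod_{a=1}^k\Big(\prod_{b=1}^{i_a-1}(t_a-z_b+\hbar)\prod_{b=i_a+1}^n(z_b-t_a)\Big)\prod_{1\le a<b\le k}\frac1{(t_b-t_a+\hbar)(t_b-t_a)},$$ $$U^{(10)}_I=\prod_{a=1}^k\Big(\prod_{b=1}^{i_a-1}(t_a-z_b+\hbar)\prod_{b=i_a+1}^n(z_b-t_a)\Big)\prod_{1\le a<b\le k}\frac1{t_b-t_a},$$ $$U^{(01)}_I=\prod_{a=1}^k\Big(\prod_{b=1}^{i_a-1}(z_b-t_a+\hbar)\prod_{b=i_a+1}^n(z_b-t_a)\Big)\prod_{1\le a<b\le k}\frac1{t_b-t_a}\cdot\hbar^k\prod_{1\le a<b\le n}(z_b-z_a+\hbar)\prod_{a=1}^k\prod_{b=1}^n\frac1{z_b-t_a+\hbar},$$ $$U^{(11)}_I=\prod_{a=1}^k\Big(\prod_{b=1}^{i_a-1}(z_b-t_a+\hbar)\prod_{b=i_a+1}^n(z_b-t_a)\Big)\prod_{1\le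 a<b\le k}\frac{t_b-t_a+\hbar}{t_b-t_a}\cdot\hbar^k\prod_{1\le a<b\le n}(z_b-z_a+\hbar)\prod_{a=1}^k\prod_{b=1}^n\frac1{z_b-t_a+\hbar}.$$ For $\sigma\in S_n$ set $W^{(r)}_{\sigma,I}=W^{(r)}_{\sigma^{-1}(I)}(t_1,\dots,t_k,z_{\sigma(1)},\dots,z_{\sigma(n)})$, i.e. take $W^{(r)}_{\sigma^{-1}(I)}$ and replace each $z_b$ by $z_{\sigma(b)}$. *)

theory Defs
  imports
    "HOL-Library.Poly_Mapping"
    "HOL-Computational_Algebra.Fraction_Field"
    "HOL-Combinatorics.Permutations"
begin

section \<open>The field of rational functions in $t_i$, $z_i$, $\hbar$\<close>

datatype rvar = T nat | Z nat | Hbar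

text \<open>
  The library proves that polynomials, as finitely supported functions on monomials
  \<^typ>\<open>rvar \<Rightarrow>\<^sub>0 nat\<close>, form an integral domain only if the variables are linearly
  ordered. The order chosen here has no other purpose.
\<close>

fun rvar_code :: "rvar \<Rightarrow> nat" where
  "rvar_code Hbar = 0"
| "rvar_code (T i) = 2 * i + 1"
| "rvar_code (Z i) = 2 * i + 2"

lemma rvar_code_eq_iff: "rvar_code x = rvar_code y \<longleftrightarrow> x = y"
  by (cases x; cases y; simp; presburger)

instantiation rvar :: linorder
begin

definition less_eq_rvar :: "rvar \<Rightarrow> rvar \<Rightarrow> bool" where
  "less_eq_rvar x y \<longleftrightarrow> rvar_code x \<le> rvar_code y"

definition less_rvar :: "rvar \<Rightarrow> rvar \<Rightarrow> bool" where
  "less_rvar x y \<longleftrightarrow> rvar_code x < rvar_code y"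

instance
  by intro_classes (auto simp: less_eq_rvar_def less_rvar_def rvar_code_eq_iff[symmetric])

end

text \<open>
  There are variables $t_i$, $z_i$ for all natural numbers $i$; for given $k \le n$ only
  $t_1, \dots, t_k, z_1, \dots, z_n, \hbar$ occur below, so the identities live in the subfield of
  rational functions in these variables.
\<close>

type_synonym 'a ratfun = "((rvar \<Rightarrow>\<^sub>0 nat) \<Rightarrow>\<^sub>0 'a) fract"

definition indet :: "rvar \<Rightarrow> 'a::field_char_0 ratfun" where
  "indet x = Fract (Poly_Mapping.single (Poly_Mapping.single x 1) 1) 1"

definition tvar :: "nat \<Rightarrow> 'a::field_char_0 ratfun" where
  "tvar i = indet (T i)"

definition zvar :: "nat \<Rightarrow> 'a::field_char_0 ratfun" where
  "zvar i = indet (Z i)"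

definition hvar :: "'a::field_char_0 ratfun" where
  "hvar = indet Hbar"

section \<open>Super weight functions\<close>

datatype super_index = R00 | R10 | R01 | R11

text \<open>\<open>nth_elem I a\<close> is $i_a$ for $I = \{i_1 < \dots < i_k\}$ and $1 \le a \le k$.\<close>

definition nth_elem :: "nat set \<Rightarrow> nat \<Rightarrow> nat" where
  "nth_elem I a = sorted_list_of_set I ! (a - 1)"

text \<open>
  The weight functions are defined as expressions in the arguments \<open>t\<close>, \<open>z\<close>, \<open>h\<close>, so that
  permuting or substituting variables is done by changing these arguments.
\<close>

fun U :: "super_index \<Rightarrow> nat \<Rightarrow> nat \<Rightarrow> nat set \<Rightarrow>
    (nat \<Rightarrow> 'b::field) \<Rightarrow> (nat \<Rightarrow> 'b) \<Rightarrow> 'b \<Rightarrow> 'b" where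
  "U R00 n k I t z h =
     (\<Prod>a\<in>{1..k}. (\<Prod>b\<in>{1..<nth_elem I a}. t a - z b + h) *
                   (\<Prod>b\<in>{nth_elem I a<..n}. z b - t a)) *
     (\<Prod>a\<in>{1..k}. \<Prod>b\<in>{a<..k}. 1 / ((t b - t a + h) * (t b - t a)))"
| "U R10 n k I t z h =
     (\<Prod>a\<in>{1..k}. (\<Prod>b\<in>{1..<nth_elem I a}. t a - z b + h) *
                   (\<Prod>b\<in>{nth_elem I a<..n}. z b - t a)) *
     (\<Prod>a\<in>{1..k}. \<Prod>b\<in>{a<..k}. 1 / (t b - t a))"
| "U R01 n k I t z h =
     (\<Prod>a\<in>{1..k}. (\<Prod>b\<in>{1..<nth_elem I a}. z b - t a + h) *
                   (\<Prod>b\<in>{nth_elem I a<..n}. z b - t a)) *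
     (\<Prod>a\<in>{1..k}. \<Prod>b\<in>{a<..k}. 1 / (t b - t a)) *
     h ^ k * (\<Prod>a\<in>{1..n}. \<Prod>b\<in>{a<..n}. z b - z a + h) *
     (\<Prod>a\<in>{1..k}. \<Prod>b\<in>{1..n}. 1 / (z b - t a + h))"
| "U R11 n k I t z h =
     (\<Prod>a\<in>{1..k}. (\<Prod>b\<in>{1..<nth_elem I a}. z b - t a + h) *
                   (\<Prod>b\<in>{nth_elem I a<..n}. z b - t a)) *
     (\<Prod>a\<in>{1..k}. \<Prod>b\<in>{a<..k}. (t b - t a + h) / (t b - t a)) *
     h ^ k * (\<Prod>a\<in>{1..n}. \<Prod>b\<in>{a<..n}. z b - z a + h) *
     (\<Prod>a\<in>{1..k}. \<Prod>b\<in>{1..n}. 1 / (z b - t a + h))"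

definition Sym :: "nat \<Rightarrow> ((nat \<Rightarrow> 'b) \<Rightarrow> 'b) \<Rightarrow> (nat \<Rightarrow> 'b) \<Rightarrow> 'b::comm_monoid_add" where
  "Sym k f t = (\<Sum>\<tau> | \<tau> permutes {1..k}. f (\<lambda>i. t (\<tau> i)))"

definition W :: "super_index \<Rightarrow> nat \<Rightarrow> nat \<Rightarrow> nat set \<Rightarrow>
    (nat \<Rightarrow> 'b::field) \<Rightarrow> (nat \<Rightarrow> 'b) \<Rightarrow> 'b \<Rightarrow> 'b" where
  "W r n k I t z h = Sym k (\<lambda>t'. U r n k I t' z h) t"

definition W_perm :: "super_index \<Rightarrow> nat \<Rightarrow> nat \<Rightarrow> (nat \<Rightarrow> nat) \<Rightarrow> nat set \<Rightarrow>
    'a::field_char_0 ratfun" where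
  "W_perm r n k \<sigma> I = W r n k (inv \<sigma> ` I) tvar (\<lambda>b. zvar (\<sigma> b)) hvar"

end

theory Submission
  imports Defs
begin

text \<open>
  Put \<open>J = \<sigma>\<^sup>-\<^sup>1(I)\<close> and \<open>y\<^sub>b = z\<^sub>\<sigma>\<^sub>(\<^sub>b\<^sub>)\<close>. Passing from \<open>\<sigma>\<close> to \<open>\<sigma> s\<close> with \<open>s = s\<^sub>a\<^sub>,\<^sub>a\<^sub>+\<^sub>1\<close> replaces \<open>J\<close> by
  \<open>s(J)\<close> and \<open>y\<close> by \<open>y \<circ> s\<close>. Each \<open>U\<close> is a product of one factor per element of \<open>J\<close>, of pair
  factors in \<open>t\<close> and in \<open>z\<close>, and of a factor symmetric in the \<open>t\<close> and in the \<open>z\<close>. Only the factors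
  of the elements \<open>a\<close>, \<open>a + 1\<close> and the pair factor of \<open>y\<^sub>a, y\<^sub>a\<^sub>+\<^sub>1\<close> feel the exchange. If \<open>J\<close> contains at
  most one of \<open>a\<close>, \<open>a + 1\<close>, the identity holds for \<open>U\<close> already. If \<open>J\<close> contains both, they sit at
  consecutive positions \<open>p\<close>, \<open>p + 1\<close>, and the identity holds after adding the term with
  \<open>t\<^sub>p\<close>, \<open>t\<^sub>p\<^sub>+\<^sub>1\<close> exchanged.
\<close>

section \<open>Products over pairs of indices\<close>

definition pair_prod :: "('b \<Rightarrow> 'b \<Rightarrow> 'b) \<Rightarrow> nat \<Rightarrow> (nat \<Rightarrow> 'b) \<Rightarrow> 'b::comm_monoid_mult" where
  "pair_prod d m x = (\<Prod>i\<in>{1..m}. \<Prod>j\<in>{i<..m}. d (x i) (x j))"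

text \<open>No index lies between \<open>a\<close> and \<open>a + 1\<close>, so the exchange keeps
  the order of every pair except this one. The two values share a factor \<open>R\<close> instead of
  being compared by a quotient, since \<open>d\<close> may take the value 0.\<close>

lemma pair_prod_transpose:
  assumes "1 \<le> a" "a + 1 \<le> m"
  obtains R where "pair_prod d m x = R * d (x a) (x (a + 1))"
    and "pair_prod d m (x \<circ> transpose a (a + 1)) = R * d (x (a + 1)) (x a)"
proof -
  define S where "S = Sigma {1..m} (\<lambda>i. {i<..m})"
  define s where "s = transpose a (a + 1)"
  define R where "R = (\<Prod>(i,j)\<in>S - {(a, a + 1)}. d (x i) (x j))"
  have fin: "finite S" and mem: "(a, a + 1) \<in> S"
    using assms by (auto simp: S_def)
  have pp: "pair_prod d m y = d (y a) (y (a + 1)) * (\<Prod>(i,j)\<in>S - {(a, a + 1)}. d (y i) (y j))" for y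
  proof -
    have "pair_prod d m y = (\<Prod>(i,j)\<in>S. d (y i) (y j))"
      unfolding pair_prod_def S_def by (subst prod.Sigma) auto
    thus ?thesis by (simp add: prod.remove[OF fin mem])
  qed
  have bij: "bij_betw (map_prod s s) (S - {(a, a + 1)}) (S - {(a, a + 1)})"
    by (rule bij_betw_byWitness[where f' = "map_prod s s"])
      (use assms in \<open>auto simp: S_def s_def transpose_def split: if_splits\<close>)
  have "(\<Prod>(i,j)\<in>S - {(a, a + 1)}. d ((x \<circ> s) i) ((x \<circ> s) j)) = R"
    unfolding R_def
    by (subst prod.reindex_bij_betw[OF bij, symmetric]) (auto intro!: prod.cong)
  then have "pair_prod d m (x \<circ> s) = R * d (x (a + 1)) (x a)"
    by (simp add: pp s_def mult.commute)
  moreover have "pair_prod d m x = R * d (x a) (x (a + 1))"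
    by (simp add: pp R_def mult.commute)
  ultimately show thesis using that by (simp add: s_def)
qed

section \<open>Increasing enumeration of a finite set\<close>

lemma strict_mono_on_nth_elem: "strict_mono_on {1..card J} (nth_elem J)"
  unfolding nth_elem_def
  by (intro strict_mono_onI sorted_wrt_nth_less[OF strict_sorted_list_of_set]) auto

lemma bij_betw_nth_elem:
  assumes "finite J"
  shows "bij_betw (nth_elem J) {1..card J} J"
proof (rule bij_betw_imageI)
  show "inj_on (nth_elem J) {1..card J}"
    by (rule strict_mono_on_imp_inj_on[OF strict_mono_on_nth_elem])
  have "nth_elem J ` {1..card J} = (\<lambda>i. sorted_list_of_set J ! i) ` ((\<lambda>c. c - 1) ` {1..card J})"
    by (simp add: nth_elem_def image_image)
  also have "(\<lambda>c. c - 1) ` {1..card J} = {..<length (sorted_list_of_set J)}"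
    by (auto simp: image_iff intro!: bexI[of _ "Suc _"])
  also have "(\<lambda>i. sorted_list_of_set J ! i) ` \<dots> = J"
    using assms by (metis lessThan_atLeast0 list.set_map map_nth set_sorted_list_of_set set_upt)
  finally show "nth_elem J ` {1..card J} = J" .
qed

text \<open>A strictly increasing list is determined by its set of entries, and \<open>s\<close>
  maps the list of \<open>J\<close> to such a list.\<close>

lemma nth_elem_image:
  assumes "finite J" "strict_mono_on J s" "c \<in> {1..card J}"
  shows "nth_elem (s ` J) c = s (nth_elem J c)"
proof -
  have "sorted_list_of_set (s ` J) = map s (sorted_list_of_set J)"
  proof (rule strict_sorted_equal)
    have "sorted_wrt (\<lambda>x y. s x < s y) (sorted_list_of_set J)"
      using assms(1,2) by (intro sorted_wrt_mono_rel[OF _ strict_sorted_list_of_set])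
        (auto simp: strict_mono_on_def)
    thus "sorted_wrt (<) (map s (sorted_list_of_set J))" by (simp add: sorted_wrt_map)
  qed (use assms(1) in auto)
  thus ?thesis using assms(3) by (auto simp: nth_elem_def)
qed

text \<open>Exchanging two neighbours reverses no other pair, so the exchange is increasing on a set
  that lacks one of them.\<close>

lemma nth_elem_transpose:
  assumes "finite J" "\<not> (a \<in> J \<and> a + 1 \<in> J)" "c \<in> {1..card J}"
  shows "nth_elem (transpose a (a + 1) ` J) c = transpose a (a + 1) (nth_elem J c)"
proof (rule nth_elem_image[OF assms(1) _ assms(3)])
  show "strict_mono_on J (transpose a (a + 1))"
    using assms(2) by (auto simp: strict_mono_on_def transpose_def)
qed

text \<open>A position strictly between those of \<open>a\<close> and \<open>a + 1\<close> would
  hold a number strictly between these two.\<close>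

lemma nth_elem_consecutive:
  assumes "finite J" "a \<in> J" "a + 1 \<in> J"
  obtains p where "1 \<le> p" "p + 1 \<le> card J" "nth_elem J p = a" "nth_elem J (p + 1) = a + 1"
proof -
  note bij = bij_betw_nth_elem[OF assms(1)]
  obtain p q where p: "p \<in> {1..card J}" "nth_elem J p = a"
    and q: "q \<in> {1..card J}" "nth_elem J q = a + 1"
    using assms(2,3) bij by (metis bij_betw_imp_surj_on imageE)
  have less: "nth_elem J c < nth_elem J c'" if "c \<in> {1..card J}" "c' \<in> {1..card J}" "c < c'" for c c'
    using strict_mono_onD[OF strict_mono_on_nth_elem that] .
  have "p < q"
    using less[OF q(1) p(1)] p q by (metis less_add_one linorder_neqE_nat not_less_iff_gr_or_eq)
  moreover have "\<not> p + 1 < q"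
  proof
    assume "p + 1 < q"
    then show False using less[of p "p + 1"] less[of "p + 1" q] p q by auto
  qed
  ultimately have "q = p + 1" by simp
  with p q show thesis using that by auto
qed

section \<open>The common shape of the four weight functions\<close>

definition chi :: "('b \<Rightarrow> 'b \<Rightarrow> 'b) \<Rightarrow> nat \<Rightarrow> nat \<Rightarrow> 'b \<Rightarrow> (nat \<Rightarrow> 'b) \<Rightarrow> 'b::field" where
  "chi \<alpha> n i t y = (\<Prod>b\<in>{1..<i}. \<alpha> t (y b)) * (\<Prod>b\<in>{i<..n}. y b - t)"

text \<open>Both \<open>a\<close> and \<open>a + 1\<close> lie on the same side of \<open>i\<close>,
  so the exchange only permutes the factors within one of the two products.\<close>

lemma chi_transpose_other:
  assumes "1 \<le> a" "a + 1 \<le> n" "i \<noteq> a" "i \<noteq> a + 1"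
  shows "chi \<alpha> n i t (y \<circ> transpose a (a + 1)) = chi \<alpha> n i t y"
proof (cases "i < a")
  case True
  then have "transpose a (a + 1) permutes {i<..n}"
    using assms by (intro permutes_swap_id) auto
  from prod.permute[OF this, of "\<lambda>b. y b - t"] True show ?thesis
    by (auto simp: chi_def o_def transpose_def intro!: prod.cong)
next
  case False
  then have "transpose a (a + 1) permutes {1..<i}"
    using assms by (intro permutes_swap_id) auto
  from prod.permute[OF this, of "\<lambda>b. \<alpha> t (y b)"] False assms show ?thesis
    by (auto simp: chi_def o_def transpose_def intro!: prod.cong)
qed

text \<open>The part common to \<open>chi\<close> at \<open>i = a\<close> and at
  \<open>i = a + 1\<close>; each of them has one further factor. It involves neither
  \<open>y a\<close> nor \<open>y (a + 1)\<close>.\<close>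

definition chi_core :: "('b \<Rightarrow> 'b \<Rightarrow> 'b) \<Rightarrow> nat \<Rightarrow> nat \<Rightarrow> 'b \<Rightarrow> (nat \<Rightarrow> 'b) \<Rightarrow> 'b::field" where
  "chi_core \<alpha> n a t y = (\<Prod>b\<in>{1..<a}. \<alpha> t (y b)) * (\<Prod>b\<in>{a + 1<..n}. y b - t)"

lemma chi_core_transpose:
  "chi_core \<alpha> n a t (y \<circ> transpose a (a + 1)) = chi_core \<alpha> n a t y"
  by (auto simp: chi_core_def transpose_def intro!: arg_cong2[where f = "(*)"] prod.cong)

lemma chi_lower:
  assumes "a + 1 \<le> n"
  shows "chi \<alpha> n a t y = chi_core \<alpha> n a t y * (y (a + 1) - t)"
proof -
  have "{a<..n} = insert (a + 1) {a + 1<..n}" using assms by auto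
  thus ?thesis by (simp add: chi_def chi_core_def algebra_simps)
qed

lemma chi_upper:
  assumes "1 \<le> a"
  shows "chi \<alpha> n (a + 1) t y = chi_core \<alpha> n a t y * \<alpha> t (y a)"
proof -
  have "{1..<a + 1} = insert a {1..<a}" using assms by auto
  thus ?thesis by (simp add: chi_def chi_core_def algebra_simps)
qed

text \<open>Together with \<open>t_pair\<close>, \<open>z_pair\<close> and \<open>sym_factor\<close>
  this carries all dependence on \<open>r\<close>. One argument then serves the four weight
  functions, and cases on \<open>r\<close> remain only in short computations.\<close>

fun alpha :: "super_index \<Rightarrow> 'b::field \<Rightarrow> 'b \<Rightarrow> 'b \<Rightarrow> 'b" where
  "alpha R00 h t y = t - y + h"
| "alpha R10 h t y = t - y + h"
| "alpha R01 h t y = y - t + h"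
| "alpha R11 h t y = y - t + h"

fun t_pair :: "super_index \<Rightarrow> 'b::field \<Rightarrow> 'b \<Rightarrow> 'b \<Rightarrow> 'b" where
  "t_pair R00 h u v = 1 / ((v - u + h) * (v - u))"
| "t_pair R10 h u v = 1 / (v - u)"
| "t_pair R01 h u v = 1 / (v - u)"
| "t_pair R11 h u v = (v - u + h) / (v - u)"

fun z_pair :: "super_index \<Rightarrow> 'b::field \<Rightarrow> 'b \<Rightarrow> 'b \<Rightarrow> 'b" where
  "z_pair R00 h x y = 1"
| "z_pair R10 h x y = 1"
| "z_pair R01 h x y = y - x + h"
| "z_pair R11 h x y = y - x + h"

fun sym_factor :: "super_index \<Rightarrow> nat \<Rightarrow> nat \<Rightarrow> (nat \<Rightarrow> 'b::field) \<Rightarrow> (nat \<Rightarrow> 'b) \<Rightarrow> 'b \<Rightarrow> 'b" where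
  "sym_factor R00 n k t y h = 1"
| "sym_factor R10 n k t y h = 1"
| "sym_factor R01 n k t y h = h ^ k * (\<Prod>c\<in>{1..k}. \<Prod>b\<in>{1..n}. 1 / (y b - t c + h))"
| "sym_factor R11 n k t y h = h ^ k * (\<Prod>c\<in>{1..k}. \<Prod>b\<in>{1..n}. 1 / (y b - t c + h))"

definition chi_prod :: "('b \<Rightarrow> 'b \<Rightarrow> 'b) \<Rightarrow> nat \<Rightarrow> nat \<Rightarrow> nat set \<Rightarrow> (nat \<Rightarrow> 'b) \<Rightarrow> (nat \<Rightarrow> 'b) \<Rightarrow> 'b::field" where
  "chi_prod \<alpha> n k J t y = (\<Prod>c\<in>{1..k}. chi \<alpha> n (nth_elem J c) (t c) y)"

lemma U_factorization:
  "U r n k J t y h =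
     chi_prod (alpha r h) n k J t y * pair_prod (t_pair r h) k t * pair_prod (z_pair r h) n y
       * sym_factor r n k t y h"
  by (cases r) (simp_all add: chi_prod_def chi_def pair_prod_def mult_ac)

lemma sym_factor_permute_z:
  assumes "p permutes {1..n}"
  shows "sym_factor r n k t (y \<circ> p) h = sym_factor r n k t y h"
proof -
  have "(\<Prod>b\<in>{1..n}. 1 / (y (p b) - t c + h)) = (\<Prod>b\<in>{1..n}. 1 / (y b - t c + h))" for c
    using prod.permute[OF assms, of "\<lambda>b. 1 / (y b - t c + h)"] by (simp add: o_def)
  thus ?thesis by (cases r) simp_all
qed

lemma sym_factor_permute_t:
  assumes "p permutes {1..k}"
  shows "sym_factor r n k (t \<circ> p) y h = sym_factor r n k t y h"
  using prod.permute[OF assms, of "\<lambda>c. \<Prod>b\<in>{1..n}. 1 / (y b - t c + h)"]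
  by (cases r) (simp_all add: o_def)

section \<open>Exchanging two adjacent variables\<close>

text \<open>All three terms share the factor \<open>F\<close>. What remains is a polynomial
  identity, so with the denominator cleared no expression has to be nonzero.\<close>

lemma U_transpose_exactly_one:
  fixes y :: "nat \<Rightarrow> 'b::field"
  assumes "1 \<le> a" "a + 1 \<le> n" "finite J" "card J = k"
    and one: "(a \<in> J) \<noteq> (a + 1 \<in> J)"
  defines "s \<equiv> transpose a (a + 1)"
  shows "(y (a + 1) - y a + h) * U r n k (s ` J) t (y \<circ> s) h =
     (y a - y (a + 1)) * U r n k J t y h + h * U r n k (s ` J) t y h"
proof -
  note bij = bij_betw_nth_elem[OF \<open>finite J\<close>, unfolded \<open>card J = k\<close>]
  have perm: "s permutes {1..n}"
    unfolding s_def using assms(1,2) by (intro permutes_swap_id) auto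
  obtain e where e: "e \<in> J" "e = a \<or> e = a + 1" "\<And>i. i \<in> J \<Longrightarrow> i \<noteq> e \<Longrightarrow> i \<noteq> a \<and> i \<noteq> a + 1"
    using one by auto
  obtain p where p: "p \<in> {1..k}" "nth_elem J p = e"
    using bij e(1) by (metis bij_betw_imp_surj_on imageE)
  have others: "nth_elem J c \<noteq> a \<and> nth_elem J c \<noteq> a + 1" if "c \<in> {1..k} - {p}" for c
  proof -
    have "nth_elem J c \<noteq> e" using that p bij by (metis DiffE bij_betw_inv_into_left singletonI)
    moreover have "nth_elem J c \<in> J" using that bij_betwE[OF bij] by blast
    ultimately show ?thesis using e(3) by blast
  qed
  \<comment> \<open>The elements of \<open>J\<close> other than \<open>e\<close> contribute the same
    product \<open>M\<close> to all three terms.\<close>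
  define M where "M = (\<Prod>c\<in>{1..k} - {p}. chi (alpha r h) n (nth_elem J c) (t c) y)"
  have sJ: "nth_elem (s ` J) c = s (nth_elem J c)" if "c \<in> {1..k}" for c
    unfolding s_def using one that assms by (intro nth_elem_transpose) auto
  have chi_other: "chi (alpha r h) n (nth_elem J c) (t c) (y \<circ> s) = chi (alpha r h) n (nth_elem J c) (t c) y"
    if "c \<in> {1..k} - {p}" for c
    unfolding s_def using others[OF that] by (intro chi_transpose_other assms(1,2)) auto
  have s_other: "s (nth_elem J c) = nth_elem J c" if "c \<in> {1..k} - {p}" for c
    using others[OF that] by (simp add: s_def)
  have 1: "chi_prod (alpha r h) n k J t y = M * chi (alpha r h) n e (t p) y"
    unfolding chi_prod_def M_def using p by (subst prod.remove[of _ p]) auto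
  have 2: "chi_prod (alpha r h) n k (s ` J) t y = M * chi (alpha r h) n (s e) (t p) y"
    unfolding chi_prod_def M_def using p
    by (subst prod.remove[of _ p]) (auto simp: sJ s_other intro!: prod.cong)
  have 3: "chi_prod (alpha r h) n k (s ` J) t (y \<circ> s) = M * chi (alpha r h) n (s e) (t p) (y \<circ> s)"
    unfolding chi_prod_def M_def using p
    by (subst prod.remove[of _ p]) (auto simp: sJ s_other chi_other intro!: prod.cong)
  obtain R where R: "pair_prod (z_pair r h) n y = R * z_pair r h (y a) (y (a + 1))"
    "pair_prod (z_pair r h) n (y \<circ> s) = R * z_pair r h (y (a + 1)) (y a)"
    unfolding s_def using pair_prod_transpose[OF assms(1,2)] by metis
  define G where "G = chi_core (alpha r h) n a (t p) y"
  define u x w where "u = t p" "x = y a" "w = y (a + 1)"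
  have lower: "chi (alpha r h) n a (t p) y = G * (w - u)"
      "chi (alpha r h) n a (t p) (y \<circ> s) = G * (x - u)"
    unfolding s_def by (simp_all add: chi_lower[OF assms(2)] chi_core_transpose[simplified] G_def u_x_w_def)
  have upper: "chi (alpha r h) n (a + 1) (t p) y = G * alpha r h u x"
      "chi (alpha r h) n (a + 1) (t p) (y \<circ> s) = G * alpha r h u w"
    using chi_core_transpose[of "alpha r h" n a "t p" y]
    unfolding s_def chi_upper[OF assms(1)] by (simp_all add: G_def u_x_w_def)
  \<comment> \<open>Only here does \<open>r\<close> matter: up to the factor \<open>G\<close>, both
    cases are polynomial identities in \<open>u\<close>, \<open>x\<close>, \<open>w\<close>,
    \<open>h\<close>, since \<open>e\<close> and \<open>s e\<close> are \<open>a\<close> and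
    \<open>a + 1\<close> in some order.\<close>
  have core: "(w - x + h) * (chi (alpha r h) n (s e) (t p) (y \<circ> s) * z_pair r h w x) =
      (x - w) * (chi (alpha r h) n e (t p) y * z_pair r h x w)
        + h * (chi (alpha r h) n (s e) (t p) y * z_pair r h x w)"
    using e(2)
  proof
    assume "e = a"
    moreover have "s a = a + 1" by (simp add: s_def)
    ultimately show ?thesis unfolding \<open>e = a\<close> \<open>s a = a + 1\<close> lower upper
      by (cases r) (simp_all add: algebra_simps)
  next
    assume "e = a + 1"
    moreover have "s (a + 1) = a" by (simp add: s_def)
    ultimately show ?thesis unfolding \<open>e = a + 1\<close> \<open>s (a + 1) = a\<close> lower upper
      by (cases r) (simp_all add: algebra_simps)
  qed
  define F where "F = M * pair_prod (t_pair r h) k t * R * sym_factor r n k t y h"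
  have "(w - x + h) * U r n k (s ` J) t (y \<circ> s) h =
      F * ((w - x + h) * (chi (alpha r h) n (s e) (t p) (y \<circ> s) * z_pair r h w x))"
    unfolding U_factorization 3 R sym_factor_permute_z[OF perm] F_def by (simp add: u_x_w_def mult_ac)
  also have "\<dots> = (x - w) * U r n k J t y h + h * U r n k (s ` J) t y h"
    unfolding core U_factorization 1 2 R F_def by (simp add: u_x_w_def algebra_simps)
  finally show ?thesis by (simp add: u_x_w_def)
qed

text \<open>No factor \<open>chi\<close> changes, so the two sides differ only in the order of the
  pair \<open>y a\<close>, \<open>y (a + 1)\<close>. Cross-multiplication avoids dividing by
  \<open>z_pair\<close>.\<close>

lemma U_transpose_neither:
  fixes y :: "nat \<Rightarrow> 'b::field"
  assumes "1 \<le> a" "a + 1 \<le> n" "finite J" "card J = k" "a \<notin> J" "a + 1 \<notin> J"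
  shows "z_pair r h (y a) (y (a + 1)) * U r n k J t (y \<circ> transpose a (a + 1)) h =
    z_pair r h (y (a + 1)) (y a) * U r n k J t y h"
proof -
  have perm: "transpose a (a + 1) permutes {1..n}"
    using assms(1,2) by (intro permutes_swap_id) auto
  have "nth_elem J c \<noteq> a \<and> nth_elem J c \<noteq> a + 1" if "c \<in> {1..k}" for c
    using bij_betwE[OF bij_betw_nth_elem[OF \<open>finite J\<close>]] that assms(4-6) by metis
  then have 1: "chi_prod (alpha r h) n k J t (y \<circ> transpose a (a + 1)) = chi_prod (alpha r h) n k J t y"
    unfolding chi_prod_def by (intro prod.cong refl chi_transpose_other[OF assms(1,2)]) auto
  obtain R where R: "pair_prod (z_pair r h) n y = R * z_pair r h (y a) (y (a + 1))"
    "pair_prod (z_pair r h) n (y \<circ> transpose a (a + 1)) = R * z_pair r h (y (a + 1)) (y a)"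
    by (rule pair_prod_transpose[OF assms(1,2)])
  show ?thesis
    unfolding U_factorization 1 R sym_factor_permute_z[OF perm] by (simp add: mult_ac)
qed

section \<open>Both \<open>a\<close> and \<open>a + 1\<close> in the set: symmetrization in two
  variables\<close>

fun both_factor :: "super_index \<Rightarrow> 'b::field \<Rightarrow> 'b \<Rightarrow> 'b \<Rightarrow> 'b" where
  "both_factor R00 h x w = 1"
| "both_factor R01 h x w = 1"
| "both_factor R10 h x w = (x - w + h) / (w - x + h)"
| "both_factor R11 h x w = (x - w + h) / (w - x + h)"

text \<open>The sum over the two orders of \<open>u\<close>, \<open>v\<close> on the left is
  \<open>x - w + h\<close> for \<open>R10\<close> and \<open>w - x + h\<close> for
  \<open>R01\<close>; in the latter case \<open>z_pair\<close> completes it to an expression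
  symmetric in \<open>x\<close> and \<open>w\<close>. For \<open>R00\<close> and \<open>R11\<close>
  the sum itself is symmetric in \<open>x\<close> and \<open>w\<close>.\<close>

lemma two_variable_identity:
  fixes u v x w h :: "'b::field"
  assumes "u \<noteq> v" "v - u + h \<noteq> 0" "u - v + h \<noteq> 0" "w - x + h \<noteq> 0"
  shows "((x - u) * alpha r h v w * t_pair r h u v + (x - v) * alpha r h u w * t_pair r h v u)
       * z_pair r h w x =
    both_factor r h x w *
      (((w - u) * alpha r h v x * t_pair r h u v + (w - v) * alpha r h u x * t_pair r h v u)
       * z_pair r h x w)"
proof -
  \<comment> \<open>In terms of \<open>d\<close> the denominators from \<open>t_pair\<close> are
    built from \<open>d\<close>, \<open>d + h\<close> and \<open>h - d\<close>, all nonzero.\<close>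
  define d where "d = v - u"
  have v: "v = u + d" "u - v = - d" by (simp_all add: d_def)
  have nz: "d \<noteq> 0" "d + h \<noteq> 0" "h - d \<noteq> 0" using assms by (auto simp: d_def algebra_simps)
  show ?thesis
  proof (cases r)
    case R00
    show ?thesis using nz assms(4) unfolding R00 v by (simp add: divide_simps) algebra
  next
    case R10
    show ?thesis using nz assms(4) unfolding R10 v by (simp add: divide_simps) algebra
  next
    case R01
    show ?thesis using nz assms(4) unfolding R01 v by (simp add: divide_simps) algebra
  next
    case R11
    show ?thesis using nz assms(4) unfolding R11 v by (simp add: divide_simps) algebra
  qed
qed

text \<open>As \<open>a\<close> and \<open>a + 1\<close> occupy neighbouring positions,
  \<open>pair_prod_transpose\<close> applies to the \<open>t\<close> as well as to the
  \<open>y\<close>. The four terms then share the factor \<open>F\<close>, and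
  \<open>two_variable_identity\<close> remains.\<close>

lemma U_transpose_both:
  fixes y :: "nat \<Rightarrow> 'b::field"
  assumes a: "1 \<le> a" "a + 1 \<le> n" and J: "finite J" "card J = k"
    and p: "1 \<le> p" "p + 1 \<le> k" "nth_elem J p = a" "nth_elem J (p + 1) = a + 1"
    and nz: "t p \<noteq> t (p + 1)" "t (p + 1) - t p + h \<noteq> 0" "t p - t (p + 1) + h \<noteq> 0"
      "y (a + 1) - y a + h \<noteq> 0"
  defines "s \<equiv> transpose a (a + 1)" and "q \<equiv> transpose p (p + 1)"
  shows "U r n k J t (y \<circ> s) h + U r n k J (t \<circ> q) (y \<circ> s) h =
    both_factor r h (y a) (y (a + 1)) * (U r n k J t y h + U r n k J (t \<circ> q) y h)"
proof -
  have permn: "s permutes {1..n}"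
    unfolding s_def using a by (intro permutes_swap_id) auto
  have permk: "q permutes {1..k}"
    unfolding q_def using p by (intro permutes_swap_id) auto
  have inj: "inj_on (nth_elem J) {1..k}"
    using bij_betw_nth_elem[OF J(1)] J(2) by (auto simp: bij_betw_def)
  have others: "nth_elem J c \<noteq> a \<and> nth_elem J c \<noteq> a + 1" if "c \<in> {1..k} - {p} - {p + 1}" for c
    using that p inj_onD[OF inj, of c p] inj_onD[OF inj, of c "p + 1"] by fastforce
  define M where "M = (\<Prod>c\<in>{1..k} - {p} - {p + 1}. chi (alpha r h) n (nth_elem J c) (t c) y)"
  have M: "(\<Prod>c\<in>{1..k} - {p} - {p + 1}. chi (alpha r h) n (nth_elem J c) (t' c) y') = M"
    if "t' = t \<or> t' = t \<circ> q" "y' = y \<or> y' = y \<circ> s" for t' y'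
    unfolding M_def
  proof (rule prod.cong[OF refl])
    fix c assume c: "c \<in> {1..k} - {p} - {p + 1}"
    then have "t' c = t c" using that(1) by (auto simp: q_def)
    moreover have "chi (alpha r h) n (nth_elem J c) (t c) y' = chi (alpha r h) n (nth_elem J c) (t c) y"
      using that(2) others[OF c] chi_transpose_other[OF a] by (auto simp: s_def)
    ultimately show "chi (alpha r h) n (nth_elem J c) (t' c) y' = chi (alpha r h) n (nth_elem J c) (t c) y"
      by simp
  qed
  have split: "chi_prod (alpha r h) n k J t' y' =
      chi (alpha r h) n a (t' p) y' * (chi (alpha r h) n (a + 1) (t' (p + 1)) y' * M)"
    if "t' = t \<or> t' = t \<circ> q" "y' = y \<or> y' = y \<circ> s" for t' y'
    unfolding M[OF that, symmetric] chi_prod_def using p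
    by (subst prod.remove[of _ p], simp, simp, subst prod.remove[of _ "p + 1"]) auto
  define u v x w where "u = t p" "v = t (p + 1)" "x = y a" "w = y (a + 1)"
  note uvxw = u_v_x_w_def
  obtain R where R: "pair_prod (z_pair r h) n y = R * z_pair r h x w"
    "pair_prod (z_pair r h) n (y \<circ> s) = R * z_pair r h w x"
    unfolding s_def uvxw by (rule pair_prod_transpose[OF a])
  obtain D where D: "pair_prod (t_pair r h) k t = D * t_pair r h u v"
    "pair_prod (t_pair r h) k (t \<circ> q) = D * t_pair r h v u"
    unfolding q_def uvxw by (rule pair_prod_transpose[OF p(1,2)])
  \<comment> \<open>As a function of its variable, since the exchange \<open>q\<close> evaluates the
    same core at \<open>u\<close> and at \<open>v\<close> in the other order; the product
    \<open>G u * G v\<close> is common to all terms.\<close>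
  define G where "G = (\<lambda>u. chi_core (alpha r h) n a u y)"
  have chi_s: "chi (alpha r h) n a u' (y \<circ> s) = G u' * (x - u')"
      "chi (alpha r h) n (a + 1) u' (y \<circ> s) = G u' * alpha r h u' w" for u'
    using chi_core_transpose[of "alpha r h" n a u' y]
    unfolding s_def chi_upper[OF a(1)] chi_lower[OF a(2)] by (simp_all add: G_def uvxw)
  have chi_1: "chi (alpha r h) n a u' y = G u' * (w - u')"
      "chi (alpha r h) n (a + 1) u' y = G u' * alpha r h u' x" for u'
    unfolding chi_upper[OF a(1)] chi_lower[OF a(2)] by (simp_all add: G_def uvxw)
  have tq: "(t \<circ> q) p = v" "(t \<circ> q) (p + 1) = u" "t p = u" "t (p + 1) = v"
    by (simp_all add: q_def uvxw)
  define F where "F = M * G u * G v * D * R * sym_factor r n k t y h"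
  note unf = U_factorization
    split[OF disjI1[OF refl] disjI1[OF refl]] split[OF disjI1[OF refl] disjI2[OF refl]]
    split[OF disjI2[OF refl] disjI1[OF refl]] split[OF disjI2[OF refl] disjI2[OF refl]]
    R D sym_factor_permute_z[OF permn] sym_factor_permute_t[OF permk]
    chi_s chi_1 tq
  have "U r n k J t (y \<circ> s) h + U r n k J (t \<circ> q) (y \<circ> s) h =
      F * (((x - u) * alpha r h v w * t_pair r h u v + (x - v) * alpha r h u w * t_pair r h v u)
       * z_pair r h w x)"
    unfolding unf by (simp add: F_def algebra_simps)
  also have "\<dots> = F * (both_factor r h x w *
      (((w - u) * alpha r h v x * t_pair r h u v + (w - v) * alpha r h u x * t_pair r h v u)
       * z_pair r h x w))"
    using nz by (subst two_variable_identity) (auto simp: uvxw)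
  also have "\<dots> = both_factor r h x w * (U r n k J t y h + U r n k J (t \<circ> q) y h)"
    unfolding unf by (simp add: F_def algebra_simps)
  finally show ?thesis by (simp add: uvxw)
qed

section \<open>Symmetrization\<close>

lemma Sym_add: "Sym k f t + Sym k g t = Sym k (\<lambda>u. f u + g u) t"
  by (simp add: Sym_def sum.distrib)

lemma Sym_mult_left: "c * Sym k f t = Sym k (\<lambda>u. c * f u) (t :: nat \<Rightarrow> 'b::field)"
  by (simp add: Sym_def sum_distrib_left)

lemma Sym_permute:
  assumes "q permutes {1..k}"
  shows "Sym k (\<lambda>u. f (u \<circ> q)) t = Sym k f t"
  using sum_permutations_compose_right[OF assms, of "\<lambda>\<tau>. f (\<lambda>i. t (\<tau> i))"]
  by (simp add: Sym_def o_def)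

text \<open>The coefficients of the identity for \<open>U\<close> do not involve the
  \<open>t\<close>, so it passes through the symmetrization.\<close>

lemma W_transpose_exactly_one:
  assumes "1 \<le> a" "a + 1 \<le> n" "finite J" "card J = k" "(a \<in> J) \<noteq> (a + 1 \<in> J)"
  defines "s \<equiv> transpose a (a + 1)"
  shows "(y (a + 1) - y a + h) * W r n k (s ` J) t (y \<circ> s) h =
     (y a - y (a + 1)) * W r n k J t y h + h * W r n k (s ` J) t y h"
  unfolding W_def Sym_mult_left Sym_add s_def U_transpose_exactly_one[OF assms(1-5)] ..

lemma W_transpose_neither:
  assumes "1 \<le> a" "a + 1 \<le> n" "finite J" "card J = k" "a \<notin> J" "a + 1 \<notin> J"
  shows "z_pair r h (y a) (y (a + 1)) * W r n k J t (y \<circ> transpose a (a + 1)) h =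
    z_pair r h (y (a + 1)) (y a) * W r n k J t y h"
  unfolding W_def Sym_mult_left U_transpose_neither[OF assms] ..

text \<open>Pairing each permutation with its composite with \<open>q\<close> writes
  \<open>2 * W\<close> as a symmetrized sum to which \<open>U_transpose_both\<close> applies term by
  term; this is why 2 must be invertible.\<close>

lemma W_transpose_both:
  fixes t :: "nat \<Rightarrow> 'b::field"
  assumes a: "1 \<le> a" "a + 1 \<le> n" and J: "finite J" "card J = k" "a \<in> J" "a + 1 \<in> J"
    and t: "\<And>i j. i \<noteq> j \<Longrightarrow> t i \<noteq> t j" "\<And>i j. t i - t j + h \<noteq> 0"
    and y: "y (a + 1) - y a + h \<noteq> 0" and two: "(2::'b) \<noteq> 0"
  defines "s \<equiv> transpose a (a + 1)"
  shows "W r n k J t (y \<circ> s) h = both_factor r h (y a) (y (a + 1)) * W r n k J t y h"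
proof -
  obtain p where p: "1 \<le> p" "p + 1 \<le> k" "nth_elem J p = a" "nth_elem J (p + 1) = a + 1"
    using nth_elem_consecutive[OF J(1,3,4)] J(2) by metis
  define q where "q = transpose p (p + 1)"
  have q: "q permutes {1..k}"
    unfolding q_def using p by (intro permutes_swap_id) auto
  have double: "2 * W r n k J t y' h = Sym k (\<lambda>u. U r n k J u y' h + U r n k J (u \<circ> q) y' h) t" for y'
    unfolding Sym_add[symmetric] Sym_permute[OF q, of "\<lambda>u. U r n k J u y' h"] W_def by simp
  have "2 * W r n k J t (y \<circ> s) h = both_factor r h (y a) (y (a + 1)) * (2 * W r n k J t y h)"
    unfolding double Sym_mult_left unfolding Sym_def
  proof (rule sum.cong[OF refl])
    fix \<tau> assume "\<tau> \<in> {\<tau>. \<tau> permutes {1..k}}"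
    \<comment> \<open>Injectivity of \<open>\<tau>\<close> keeps the two permuted variables at
      positions \<open>p\<close> and \<open>p + 1\<close> distinct.\<close>
    then have "\<tau> p \<noteq> \<tau> (p + 1)" by (metis mem_Collect_eq n_not_Suc_n permutes_inj injD Suc_eq_plus1)
    then show "U r n k J (\<lambda>i. t (\<tau> i)) (y \<circ> s) h + U r n k J ((\<lambda>i. t (\<tau> i)) \<circ> q) (y \<circ> s) h =
      both_factor r h (y a) (y (a + 1)) *
        (U r n k J (\<lambda>i. t (\<tau> i)) y h + U r n k J ((\<lambda>i. t (\<tau> i)) \<circ> q) y h)"
      unfolding s_def q_def by (intro U_transpose_both a J p t y) auto
  qed
  then have "2 * W r n k J t (y \<circ> s) h = 2 * (both_factor r h (y a) (y (a + 1)) * W r n k J t y h)"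
    by (simp add: mult_ac)
  with two show ?thesis by (simp only: mult_cancel_left) simp
qed

section \<open>Nonvanishing denominators\<close>

lemma indet_inject: "(indet x :: 'a::field_char_0 ratfun) = indet y \<longleftrightarrow> x = y"
proof -
  have "x = y" if "Poly_Mapping.single (Poly_Mapping.single x (1::nat)) (1::'a) =
      Poly_Mapping.single (Poly_Mapping.single y 1) 1"
    using that by (metis lookup_single_eq lookup_single_not_eq zero_neq_one)
  thus ?thesis by (auto simp: indet_def eq_fract)
qed

text \<open>The monomial of \<open>Hbar\<close> has coefficient 1 in the underlying polynomial,
  because neither \<open>x\<close> nor \<open>y\<close> contributes to it. The case
  \<open>x = y\<close> is included.\<close>

lemma indet_diff_hvar_nonzero:
  assumes "x \<noteq> Hbar" "y \<noteq> Hbar"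
  shows "indet x - indet y + hvar \<noteq> (0 :: 'a::field_char_0 ratfun)"
proof
  let ?m = "\<lambda>x. Poly_Mapping.single (Poly_Mapping.single x (1::nat)) (1::'a)"
  assume "indet x - indet y + hvar = (0 :: 'a ratfun)"
  then have "?m x - ?m y + ?m Hbar = 0"
    by (simp add: indet_def hvar_def Zero_fract_def eq_fract)
  then have "Poly_Mapping.lookup (?m x - ?m y + ?m Hbar) (Poly_Mapping.single Hbar 1) = 0"
    by simp
  moreover have "Poly_Mapping.single x (1::nat) \<noteq> Poly_Mapping.single Hbar 1" if "x \<noteq> Hbar" for x
    using that by (metis lookup_single_eq lookup_single_not_eq zero_neq_one)
  ultimately show False
    using assms by (simp add: lookup_add lookup_minus lookup_single)
qed

lemma two_ratfun_nonzero: "(2 :: 'a::field_char_0 ratfun) \<noteq> 0"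
proof
  assume "(2 :: 'a ratfun) = 0"
  then have "(of_nat 2 :: 'a ratfun) = 0" by simp
  then show False by (simp only: of_nat_fract Zero_fract_def) (simp add: eq_fract)
qed

section \<open>Transfer of the exchange identities from \<open>W\<close> to
  \<open>W_perm\<close>\<close>

theorem theorem6p5:
  fixes k n a :: nat and \<sigma> :: "nat \<Rightarrow> nat" and I :: "nat set"
  assumes "k \<le> n"
    and "\<sigma> permutes {1..n}"
    and "I \<subseteq> {1..n}" and "card I = k"
    and "a \<in> {1..n - 1}"
  shows
    "((\<sigma> a \<in> I \<and> \<sigma> (a + 1) \<notin> I) \<or> (\<sigma> a \<notin> I \<and> \<sigma> (a + 1) \<in> I) \<longrightarrow>
        (\<forall>r \<in> {R00, R10, R01, R11}.
          (W_perm r n k (\<sigma> \<circ> transpose a (a + 1)) I :: 'a::field_char_0 ratfun) =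
            (zvar (\<sigma> a) - zvar (\<sigma> (a + 1))) / (zvar (\<sigma> (a + 1)) - zvar (\<sigma> a) + hvar)
              * W_perm r n k \<sigma> I
            + hvar / (zvar (\<sigma> (a + 1)) - zvar (\<sigma> a) + hvar)
              * W_perm r n k \<sigma> (transpose (\<sigma> a) (\<sigma> (a + 1)) ` I)))
     \<and> (\<sigma> a \<in> I \<and> \<sigma> (a + 1) \<in> I \<longrightarrow>
        (\<forall>r \<in> {R00, R01}.
          (W_perm r n k (\<sigma> \<circ> transpose a (a + 1)) I :: 'a ratfun) = W_perm r n k \<sigma> I) \<and>
        (\<forall>r \<in> {R10, R11}.
          (W_perm r n k (\<sigma> \<circ> transpose a (a + 1)) I :: 'a ratfun) =
            (zvar (\<sigma> a) - zvar (\<sigma> (a + 1)) + hvar) / (zvar (\<sigma> (a + 1)) - zvar (\<sigma> a) + hvar)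
              * W_perm r n k \<sigma> I))
     \<and> (\<sigma> a \<notin> I \<and> \<sigma> (a + 1) \<notin> I \<longrightarrow>
        (\<forall>r \<in> {R00, R10}.
          (W_perm r n k (\<sigma> \<circ> transpose a (a + 1)) I :: 'a ratfun) = W_perm r n k \<sigma> I) \<and>
        (\<forall>r \<in> {R01, R11}.
          (W_perm r n k (\<sigma> \<circ> transpose a (a + 1)) I :: 'a ratfun) =
            (zvar (\<sigma> a) - zvar (\<sigma> (a + 1)) + hvar) / (zvar (\<sigma> (a + 1)) - zvar (\<sigma> a) + hvar)
              * W_perm r n k \<sigma> I))"
proof -
  define s where "s = transpose a (a + 1)"
  define J where "J = inv \<sigma> ` I"
  define y :: "nat \<Rightarrow> 'a ratfun" where "y = (\<lambda>b. zvar (\<sigma> b))"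
  have a: "1 \<le> a" "a + 1 \<le> n" using assms(5) by auto
  have bij: "bij \<sigma>" using assms(2) by (rule permutes_bij)
  have J: "finite J" "card J = k"
    using assms(3,4) finite_subset bij_imp_bij_inv[OF bij]
    by (auto simp: J_def card_image bij_def inj_on_subset)
  have mem: "b \<in> J \<longleftrightarrow> \<sigma> b \<in> I" for b
    using bij by (auto simp: J_def bij_inv_eq_iff image_iff)
  have W0: "W_perm r n k \<sigma> I = W r n k J tvar y hvar" for r
    by (simp add: W_perm_def J_def y_def)
  have W1: "W_perm r n k (\<sigma> \<circ> s) I = W r n k (s ` J) tvar (y \<circ> s) hvar" for r
  proof -
    have "inv (\<sigma> \<circ> s) = s \<circ> inv \<sigma>"
      using bij by (simp add: s_def o_inv_distrib)
    thus ?thesis by (simp add: W_perm_def J_def y_def o_def image_image)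
  qed
  have W2: "W_perm r n k \<sigma> (transpose (\<sigma> a) (\<sigma> (a + 1)) ` I) = W r n k (s ` J) tvar y hvar" for r
  proof -
    have "inv \<sigma> (transpose (\<sigma> a) (\<sigma> (a + 1)) i) = s (inv \<sigma> i)" for i
      using bij unfolding s_def
      by (metis bij_inv_eq_iff transpose_apply_commute)
    thus ?thesis by (simp add: W_perm_def J_def y_def image_image)
  qed
  have nz: "zvar i - zvar j + hvar \<noteq> (0 :: 'a ratfun)" for i j
    unfolding zvar_def by (rule indet_diff_hvar_nonzero) auto
  \<comment> \<open>In parts (2) and (3) the set is invariant, so only the variables
    \<open>y\<close> are exchanged.\<close>
  have sJ: "s ` J = J" if "(a \<in> J) = (a + 1 \<in> J)"
    unfolding s_def using that by (rule transpose_image_eq)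
  have part1: "W_perm r n k (\<sigma> \<circ> s) I =
            (zvar (\<sigma> a) - zvar (\<sigma> (a + 1))) / (zvar (\<sigma> (a + 1)) - zvar (\<sigma> a) + hvar)
              * W_perm r n k \<sigma> I
            + hvar / (zvar (\<sigma> (a + 1)) - zvar (\<sigma> a) + hvar)
              * (W_perm r n k \<sigma> (transpose (\<sigma> a) (\<sigma> (a + 1)) ` I) :: 'a ratfun)"
    if "(\<sigma> a \<in> I) \<noteq> (\<sigma> (a + 1) \<in> I)" for r
  proof -
    have "W r n k (s ` J) tvar (y \<circ> s) hvar * (y (a + 1) - y a + hvar) =
       (y a - y (a + 1)) * W r n k J tvar y hvar + hvar * W r n k (s ` J) tvar y hvar"
      using that unfolding s_def
      by (subst mult.commute, intro W_transpose_exactly_one a J) (simp add: mem)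
    moreover have "y (a + 1) - y a + hvar \<noteq> 0" unfolding y_def by (rule nz)
    ultimately have "W r n k (s ` J) tvar (y \<circ> s) hvar =
       ((y a - y (a + 1)) * W r n k J tvar y hvar + hvar * W r n k (s ` J) tvar y hvar)
         / (y (a + 1) - y a + hvar)"
      by (metis nonzero_eq_divide_eq)
    then show ?thesis
      unfolding W0 W1 W2 by (simp add: y_def add_divide_distrib)
  qed
  have part2: "W_perm r n k (\<sigma> \<circ> s) I =
      both_factor r hvar (zvar (\<sigma> a)) (zvar (\<sigma> (a + 1))) * (W_perm r n k \<sigma> I :: 'a ratfun)"
    if "\<sigma> a \<in> I" "\<sigma> (a + 1) \<in> I" for r
  proof -
    have "W r n k J tvar (y \<circ> s) hvar = both_factor r hvar (y a) (y (a + 1)) * W r n k J tvar y hvar"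
      unfolding s_def
    proof (intro W_transpose_both a J two_ratfun_nonzero)
      show "(tvar i :: 'a ratfun) \<noteq> tvar j" if "i \<noteq> j" for i j
        using that by (simp add: tvar_def indet_inject)
      show "(tvar i - tvar j + hvar :: 'a ratfun) \<noteq> 0" for i j
        unfolding tvar_def by (rule indet_diff_hvar_nonzero) auto
    qed (use that nz in \<open>auto simp: mem y_def\<close>)
    then show ?thesis using sJ that by (simp add: W0 W1 mem y_def)
  qed
  \<comment> \<open>The quotient of the two values of \<open>z_pair\<close> is 1 for
    \<open>R00\<close>, \<open>R10\<close> and the stated fraction for \<open>R01\<close>,
    \<open>R11\<close>.\<close>
  have part3: "W_perm r n k (\<sigma> \<circ> s) I =
      z_pair r hvar (zvar (\<sigma> (a + 1))) (zvar (\<sigma> a)) / z_pair r hvar (zvar (\<sigma> a)) (zvar (\<sigma> (a + 1)))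
        * (W_perm r n k \<sigma> I :: 'a ratfun)"
    if "\<sigma> a \<notin> I" "\<sigma> (a + 1) \<notin> I" for r
  proof -
    have "z_pair r hvar (y a) (y (a + 1)) * W r n k J tvar (y \<circ> s) hvar =
        z_pair r hvar (y (a + 1)) (y a) * W r n k J tvar y hvar"
      unfolding s_def using that by (intro W_transpose_neither a J) (simp_all add: mem)
    moreover have "z_pair r hvar (y a) (y (a + 1)) \<noteq> 0"
      using nz by (cases r) (auto simp: y_def)
    ultimately show ?thesis using sJ that by (simp add: W0 W1 mem y_def field_simps)
  qed
  show ?thesis
    unfolding s_def[symmetric] using part1 part2 part3 by auto
qed

end
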